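(* Let $\mathcal X=\{x^2y+z^2+x+t^3=0\}\subset\mathbb A^4_{\mathbb C}$ be the Russell cubic threefold. Then the automorphism group $\operatorname{Aut}(\mathcal X\times\mathbb A^1)$ acts transitively on $\mathcal X\times\mathbb A^1$.
   Context: Everything is over $\mathbb C$; $\operatorname{Aut}$ denotes the group of algebraic automorphisms of an affine variety. *)

theory Defs
  imports "HOL-Analysis.Analysis" "HOL-Algebra.Group_Action"
begin

text \<open>
  Affine varieties over the complex numbers are represented by their sets of closed points,
  Zariski closed in an affine space \<open>complex^'n\<close>. Polynomial functions form the
  \<open>\<complex>\<close>-algebra generated by the coordinate functions; as \<open>\<complex>\<close> is infinite, they are
  in bijection with polynomials in \<open>CARD('n)\<close> variables.
\<close>

inductive complex_polynomial_function :: "(complex^'n \<Rightarrow> complex) \<Rightarrow> bool" where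
  const: "complex_polynomial_function (\<lambda>x. c)"
| coord: "complex_polynomial_function (\<lambda>x. x $ i)"
| add: "\<lbrakk>complex_polynomial_function f; complex_polynomial_function g\<rbrakk>
    \<Longrightarrow> complex_polynomial_function (\<lambda>x. f x + g x)"
| mult: "\<lbrakk>complex_polynomial_function f; complex_polynomial_function g\<rbrakk>
    \<Longrightarrow> complex_polynomial_function (\<lambda>x. f x * g x)"

definition regular_function_on :: "(complex^'n) set \<Rightarrow> (complex^'n \<Rightarrow> complex) \<Rightarrow> bool" where
  "regular_function_on V f \<longleftrightarrow>
    (\<exists>p. complex_polynomial_function p \<and> (\<forall>x\<in>V. f x = p x))"

definition affine_morphism ::
  "(complex^'n) set \<Rightarrow> (complex^'m) set \<Rightarrow> (complex^'n \<Rightarrow> complex^'m) \<Rightarrow> bool" where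
  "affine_morphism V W f \<longleftrightarrow> f \<in> V \<rightarrow> W \<and> (\<forall>i. regular_function_on V (\<lambda>x. f x $ i))"

text \<open>
  The group structure is composition, inherited from \<^const>\<open>BijGroup\<close>. The condition on the
  inverse is needed, as automorphisms are the invertible morphisms.
\<close>

definition variety_Aut :: "(complex^'n) set \<Rightarrow> (complex^'n \<Rightarrow> complex^'n) monoid" where
  "variety_Aut V = BijGroup V
    \<lparr>carrier := {f \<in> Bij V. affine_morphism V V f \<and> affine_morphism V V (inv_into V f)}\<rparr>"

text \<open>The product lies in the affine space whose coordinates are those of both factors.\<close>

definition variety_prod ::
  "(complex^'n) set \<Rightarrow> (complex^'m) set \<Rightarrow> (complex^('n + 'm)) set" where
  "variety_prod V W =
    {p. (\<chi> i. p $ Inl i) \<in> V \<and> (\<chi> j. p $ Inr j) \<in> W}"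

abbreviation affine_line :: "(complex^1) set" where
  "affine_line \<equiv> UNIV"

text \<open>The coordinates \<open>x, y, z, t\<close> are numbered 1 to 4; in the type \<open>4\<close>, the index 4 is 0.\<close>

definition russell_cubic :: "(complex^4) set" where
  "russell_cubic = {p. let x = p $ 1; y = p $ 2; z = p $ 3; t = p $ 4
    in x^2 * y + z^2 + x + t^3 = 0}"

end

theory Submission
  imports Defs
begin

text \<open>
  The action on the Russell cubic \<open>x\<^sup>2y + z\<^sup>2 + x + t\<^sup>3 = 0\<close> itself cannot be transitive, because
  every automorphism of it preserves the hyperplane section \<open>x = 0\<close>. The point is therefore to find
  an automorphism of the cylinder, with extra coordinate \<open>w\<close>, that does not.

  Put \<open>Z = z - xw\<close>, \<open>Y = y + w\<^sup>2\<close> and \<open>u = 1 + 2wZ + xY\<close>. The equation of the cylinder becomes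
  \<open>xu + Z\<^sup>2 + t\<^sup>3 = 0\<close>, so that the cylinder maps to a threefold in which \<open>x\<close> and \<open>u\<close> play symmetric
  roles. With \<open>\<theta> = ZY - 2uw\<close> one finds on the cylinder
    \<open>\<theta>Z = -t\<^sup>3Y - u(u - 1)\<close>, \<open>2uw = ZY - \<theta>\<close> and \<open>\<theta>x = Z(u - 1) + 2wt\<^sup>3\<close>.
  Hence \<open>(t, u, \<theta>, Y)\<close> are coordinates on the open set \<open>u\<theta> \<noteq> 0\<close>, which is identified with an open
  set of affine four-space. The vector field \<open>\<partial>/\<partial>t\<close> of this chart has poles along \<open>u\<theta> = 0\<close>, but
  \<open>2u\<^sup>2\<theta>\<^sup>2 \<partial>/\<partial>t\<close> is regular on the cylinder. It is locally nilpotent since \<open>u\<close>, \<open>\<theta>\<close> and \<open>Y\<close> are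
  constants for it; its flow \<open>cylinder_flow\<close> is thus an algebraic action of the additive group.

  The chart meets every line in the cylinder along which \<open>w\<close> varies over a point with \<open>x = 0\<close>, also
  over the singular point \<open>z = t = 0\<close> of the cuspidal curve, and there the flow changes \<open>x\<close>
  (\<open>cylinder_flow_leaves_zero_section\<close>). So every point can be moved to one with \<open>x \<noteq> 0\<close>. The
  points with \<open>x \<noteq> 0\<close> form a single orbit, by the torus action with weights \<open>(6, -6, 3, 2, 0)\<close> and by
  the translations of \<open>(z, t)\<close> by multiples of \<open>x\<^sup>2\<close>, for which \<open>y\<close> can compensate.
\<close>

section \<open>Polynomial functions\<close>

lemma complex_polynomial_function_uminus:
  assumes "complex_polynomial_function f"
  shows "complex_polynomial_function (\<lambda>x. - f x)"
  using complex_polynomial_function.mult[OF complex_polynomial_function.const[of "-1"] assms] by simp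

lemma complex_polynomial_function_diff:
  assumes "complex_polynomial_function f" "complex_polynomial_function g"
  shows "complex_polynomial_function (\<lambda>x. f x - g x)"
  using complex_polynomial_function.add[OF assms(1) complex_polynomial_function_uminus[OF assms(2)]]
  by simp

lemma complex_polynomial_function_power:
  assumes "complex_polynomial_function f"
  shows "complex_polynomial_function (\<lambda>x. f x ^ n)"
  by (induction n) (auto intro: complex_polynomial_function.intros assms)

lemmas complex_polynomial_function_intros =
  complex_polynomial_function.intros complex_polynomial_function_uminus
  complex_polynomial_function_diff complex_polynomial_function_power

lemma complex_polynomial_function_compose:
  fixes f :: "complex^'n \<Rightarrow> complex^'m"
  assumes "complex_polynomial_function p" "\<And>i. complex_polynomial_function (\<lambda>x. f x $ i)"
  shows "complex_polynomial_function (\<lambda>x. p (f x))"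
  using assms(1) by induction (auto intro: complex_polynomial_function.intros assms(2))

section \<open>The automorphism group of an affine variety\<close>

lemma affine_morphism_cong:
  assumes "\<And>x. x \<in> V \<Longrightarrow> f x = g x"
  shows "affine_morphism V W f \<longleftrightarrow> affine_morphism V W g"
  using assms by (simp add: affine_morphism_def regular_function_on_def Pi_def cong: ball_cong)

lemma affine_morphism_id: "affine_morphism V V (\<lambda>x. x)"
  unfolding affine_morphism_def regular_function_on_def
  by (auto intro: complex_polynomial_function.coord)

lemma affine_morphism_compose:
  assumes "affine_morphism U V f" "affine_morphism V W g"
  shows "affine_morphism U W (\<lambda>x. g (f x))"
  unfolding affine_morphism_def
proof (intro conjI allI)
  show "(\<lambda>x. g (f x)) \<in> U \<rightarrow> W"
    using assms by (auto simp: affine_morphism_def)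
next
  fix j
  obtain q where q: "\<And>i. complex_polynomial_function (q i)" "\<And>i x. x \<in> U \<Longrightarrow> f x $ i = q i x"
    using assms(1) unfolding affine_morphism_def regular_function_on_def by metis
  obtain p where p: "complex_polynomial_function p" "\<And>y. y \<in> V \<Longrightarrow> g y $ j = p y"
    using assms(2) unfolding affine_morphism_def regular_function_on_def by metis
  have "complex_polynomial_function (\<lambda>x. p (\<chi> i. q i x))"
    by (rule complex_polynomial_function_compose[OF p(1)]) (simp add: q(1))
  moreover have "g (f x) $ j = p (\<chi> i. q i x)" if "x \<in> U" for x
  proof -
    have "f x = (\<chi> i. q i x)"
      using q(2) that by (simp add: vec_eq_iff)
    moreover have "f x \<in> V"
      using assms(1) that by (auto simp: affine_morphism_def)
    ultimately show ?thesis
      using p(2) by simp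
  qed
  ultimately show "regular_function_on U (\<lambda>x. g (f x) $ j)"
    unfolding regular_function_on_def by blast
qed

lemma variety_Aut_memI:
  assumes "affine_morphism V V f" "affine_morphism V V g"
    and "\<And>x. x \<in> V \<Longrightarrow> g (f x) = x" "\<And>x. x \<in> V \<Longrightarrow> f (g x) = x"
  shows "restrict f V \<in> carrier (variety_Aut V)"
proof -
  have bij: "bij_betw f V V"
    using assms by (intro bij_betwI[where g = g]) (auto simp: affine_morphism_def)
  then have "restrict f V \<in> Bij V"
    by (simp add: Bij_def)
  moreover have "affine_morphism V V (restrict f V)"
    using assms(1) by (subst affine_morphism_cong[where g = f]) auto
  moreover have "inv_into V (restrict f V) x = g x" if "x \<in> V" for x
  proof (rule inv_into_f_eq)
    show "inj_on (restrict f V) V"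
      using bij by (simp add: bij_betw_def)
    show "g x \<in> V"
      using assms(2) that by (auto simp: affine_morphism_def)
    then show "restrict f V (g x) = x"
      using assms(4) that by simp
  qed
  then have "affine_morphism V V (inv_into V (restrict f V))"
    using assms(2) by (subst affine_morphism_cong[where g = g]) auto
  ultimately show ?thesis
    by (simp add: variety_Aut_def)
qed

lemma variety_Aut_memD:
  assumes "f \<in> carrier (variety_Aut V)"
  shows "f \<in> Bij V" "affine_morphism V V f" "affine_morphism V V (inv_into V f)"
    "\<And>x. x \<in> V \<Longrightarrow> f x \<in> V" "\<And>x. x \<in> V \<Longrightarrow> inv_into V f x \<in> V"
    "\<And>x. x \<in> V \<Longrightarrow> inv_into V f (f x) = x" "\<And>x. x \<in> V \<Longrightarrow> f (inv_into V f x) = x"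
  using assms
  by (auto simp: variety_Aut_def Bij_def affine_morphism_def bij_betw_def f_inv_into_f)

lemma subgroup_variety_Aut: "subgroup (carrier (variety_Aut V)) (BijGroup V)"
proof (rule subgroup.intro)
  show "carrier (variety_Aut V) \<subseteq> carrier (BijGroup V)"
    by (auto simp: variety_Aut_def BijGroup_def)
next
  fix f g
  assume f: "f \<in> carrier (variety_Aut V)" and g: "g \<in> carrier (variety_Aut V)"
  have "restrict (\<lambda>x. f (g x)) V \<in> carrier (variety_Aut V)"
    by (rule variety_Aut_memI[where g = "\<lambda>x. inv_into V g (inv_into V f x)"])
      (auto intro: affine_morphism_compose[OF variety_Aut_memD(2)[OF g] variety_Aut_memD(2)[OF f]]
        affine_morphism_compose[OF variety_Aut_memD(3)[OF f] variety_Aut_memD(3)[OF g]]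
        simp: variety_Aut_memD[OF f] variety_Aut_memD[OF g])
  then show "f \<otimes>\<^bsub>BijGroup V\<^esub> g \<in> carrier (variety_Aut V)"
    using variety_Aut_memD(1)[OF f] variety_Aut_memD(1)[OF g]
    by (simp add: BijGroup_def compose_def)
next
  show "\<one>\<^bsub>BijGroup V\<^esub> \<in> carrier (variety_Aut V)"
    using variety_Aut_memI[OF affine_morphism_id affine_morphism_id, of V]
    by (simp add: BijGroup_def)
next
  fix f
  assume f: "f \<in> carrier (variety_Aut V)"
  have "restrict (inv_into V f) V \<in> carrier (variety_Aut V)"
    by (rule variety_Aut_memI[where g = f]) (simp_all add: variety_Aut_memD[OF f])
  then show "inv\<^bsub>BijGroup V\<^esub> f \<in> carrier (variety_Aut V)"
    by (simp add: inv_BijGroup variety_Aut_memD(1)[OF f])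
qed

lemma variety_Aut_eq: "variety_Aut V = BijGroup V\<lparr>carrier := carrier (variety_Aut V)\<rparr>"
  by (simp add: variety_Aut_def)

lemma group_variety_Aut: "group (variety_Aut V)"
  by (subst variety_Aut_eq) (rule subgroup.subgroup_is_group[OF subgroup_variety_Aut group_BijGroup])

lemma group_action_variety_Aut: "group_action (variety_Aut V) V (\<lambda>g. g)"
proof -
  have "(\<lambda>g. g) \<in> hom (variety_Aut V) (BijGroup V)"
    by (auto simp: hom_def variety_Aut_def BijGroup_def)
  then show ?thesis
    by (simp add: group_action_def group_hom_def group_hom_axioms_def group_variety_Aut
        group_BijGroup)
qed

text \<open>
  The orbit relation of the automorphism group is used below only through its being an equivalence
  relation that contains each pair related by an explicit automorphism.
\<close>

definition aut_related :: "(complex^'n) set \<Rightarrow> complex^'n \<Rightarrow> complex^'n \<Rightarrow> bool" where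
  "aut_related V p q \<longleftrightarrow> p \<in> V \<and> q \<in> V \<and> q \<in> orbit (variety_Aut V) (\<lambda>g. g) p"

lemma aut_related_sym: "aut_related V p q \<Longrightarrow> aut_related V q p"
  using group_action.orbit_sym[OF group_action_variety_Aut] by (auto simp: aut_related_def)

lemma aut_related_trans [trans]:
  "aut_related V p q \<Longrightarrow> aut_related V q r \<Longrightarrow> aut_related V p r"
  using group_action.orbit_trans[OF group_action_variety_Aut] by (auto simp: aut_related_def)

lemma aut_relatedI:
  assumes "affine_morphism V V f" "affine_morphism V V g"
    and "\<And>x. x \<in> V \<Longrightarrow> g (f x) = x" "\<And>x. x \<in> V \<Longrightarrow> f (g x) = x" and "p \<in> V"
  shows "aut_related V p (f p)"
  using variety_Aut_memI[OF assms(1-4)] assms(1,5)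
  by (force simp: aut_related_def orbit_def affine_morphism_def intro!: exI[of _ "restrict f V"])

lemma transitive_action_variety_AutI:
  assumes "\<And>p. p \<in> V \<Longrightarrow> aut_related V p b"
  shows "transitive_action (variety_Aut V) V (\<lambda>g. g)"
proof -
  have "aut_related V p q" if "p \<in> V" "q \<in> V" for p q
    using assms that aut_related_sym aut_related_trans by blast
  then show ?thesis
    using group_action_variety_Aut
    by (fastforce simp: transitive_action_def transitive_action_axioms_def aut_related_def orbit_def)
qed

section \<open>Coordinates on the cylinder\<close>

abbreviation russell_cylinder :: "(complex^(4 + 1)) set" where
  "russell_cylinder \<equiv> variety_prod russell_cubic affine_line"

definition point :: "complex \<Rightarrow> complex \<Rightarrow> complex \<Rightarrow> complex \<Rightarrow> complex \<Rightarrow> complex^(4 + 1)" where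
  "point x y z t w = (\<chi> i. case i of
      Inl j \<Rightarrow> if j = 1 then x else if j = 2 then y else if j = 3 then z else t
    | Inr _ \<Rightarrow> w)"

abbreviation coord_x :: "complex^(4 + 1) \<Rightarrow> complex" where "coord_x p \<equiv> p $ Inl 1"
abbreviation coord_y :: "complex^(4 + 1) \<Rightarrow> complex" where "coord_y p \<equiv> p $ Inl 2"
abbreviation coord_z :: "complex^(4 + 1) \<Rightarrow> complex" where "coord_z p \<equiv> p $ Inl 3"
abbreviation coord_t :: "complex^(4 + 1) \<Rightarrow> complex" where "coord_t p \<equiv> p $ Inl 4"
abbreviation coord_w :: "complex^(4 + 1) \<Rightarrow> complex" where "coord_w p \<equiv> p $ Inr 1"

lemma point_coords [simp]:
  "coord_x (point x y z t w) = x" "coord_y (point x y z t w) = y" "coord_z (point x y z t w) = z"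
  "coord_t (point x y z t w) = t" "coord_w (point x y z t w) = w"
  by (simp_all add: point_def)

lemma forall_coords:
  "(\<forall>i::4 + 1. P i) \<longleftrightarrow> P (Inl 1) \<and> P (Inl 2) \<and> P (Inl 3) \<and> P (Inl 4) \<and> P (Inr 1)"
  by (auto simp: split_sum_all forall_4 forall_1)

lemma point_of_coords: "p = point (coord_x p) (coord_y p) (coord_z p) (coord_t p) (coord_w p)"
  by (simp add: vec_eq_iff forall_coords)

lemma russell_cylinder_iff:
  "p \<in> russell_cylinder \<longleftrightarrow> coord_x p ^ 2 * coord_y p + coord_z p ^ 2 + coord_x p + coord_t p ^ 3 = 0"
  by (simp add: variety_prod_def russell_cubic_def Let_def)

lemma affine_morphism_pointI:
  assumes "\<And>p. p \<in> V \<Longrightarrow> point (x p) (y p) (z p) (t p) (w p) \<in> W"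
    and "complex_polynomial_function x" "complex_polynomial_function y"
      "complex_polynomial_function z" "complex_polynomial_function t"
      "complex_polynomial_function w"
  shows "affine_morphism V W (\<lambda>p. point (x p) (y p) (z p) (t p) (w p))"
proof -
  have "\<forall>i. complex_polynomial_function (\<lambda>p. point (x p) (y p) (z p) (t p) (w p) $ i)"
    using assms(2-) by (simp add: forall_coords)
  then show ?thesis
    using assms(1) unfolding affine_morphism_def regular_function_on_def by blast
qed

section \<open>Automorphisms that preserve the fibration by x\<close>

definition torus :: "complex \<Rightarrow> complex^(4 + 1) \<Rightarrow> complex^(4 + 1)" where
  "torus c p = point (c ^ 6 * coord_x p) (inverse c ^ 6 * coord_y p) (c ^ 3 * coord_z p)
     (c ^ 2 * coord_t p) (coord_w p)"

lemma torus_mem: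
  assumes "c \<noteq> 0" "p \<in> russell_cylinder"
  shows "torus c p \<in> russell_cylinder"
proof -
  have "(c ^ 6 * x)\<^sup>2 * (inverse c ^ 6 * y) + (c ^ 3 * z)\<^sup>2 + c ^ 6 * x + (c\<^sup>2 * t) ^ 3
      = c ^ 6 * (x\<^sup>2 * y + z\<^sup>2 + x + t ^ 3)" for x y z t
    using assms(1) by (simp add: field_simps flip: power_mult)
  then show ?thesis
    using assms(2) by (simp add: russell_cylinder_iff torus_def)
qed

lemma affine_morphism_torus:
  assumes "c \<noteq> 0"
  shows "affine_morphism russell_cylinder russell_cylinder (torus c)"
  using torus_mem[OF assms] unfolding torus_def
  by (intro affine_morphism_pointI complex_polynomial_function_intros) simp

lemma aut_related_torus:
  assumes "c \<noteq> 0" "p \<in> russell_cylinder"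
  shows "aut_related russell_cylinder p (torus c p)"
proof (rule aut_relatedI[where g = "torus (inverse c)"])
  show "torus (inverse c) (torus c p) = p" "torus c (torus (inverse c) p) = p" for p
    using assms(1)
    by (simp_all add: torus_def vec_eq_iff forall_coords power_inverse)
qed (use assms in \<open>auto intro: affine_morphism_torus\<close>)

text \<open>
  The factor \<open>x\<^sup>2\<close> makes the change of \<open>z\<^sup>2 + t\<^sup>3\<close> divisible by \<open>x\<^sup>2\<close>, so that a polynomial
  correction of \<open>y\<close> absorbs it.
\<close>

definition shift :: "complex \<Rightarrow> complex \<Rightarrow> complex \<Rightarrow> complex^(4 + 1) \<Rightarrow> complex^(4 + 1)" where
  "shift a b c p = point (coord_x p)
     (coord_y p - (2 * a * coord_z p + a\<^sup>2 * coord_x p ^ 2 + 3 * b * coord_t p ^ 2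
        + 3 * b\<^sup>2 * coord_t p * coord_x p ^ 2 + b ^ 3 * coord_x p ^ 4))
     (coord_z p + a * coord_x p ^ 2) (coord_t p + b * coord_x p ^ 2) (coord_w p + c)"

lemma shift_mem:
  assumes "p \<in> russell_cylinder"
  shows "shift a b c p \<in> russell_cylinder"
proof -
  have "x\<^sup>2 * (y - (2 * a * z + a\<^sup>2 * x\<^sup>2 + 3 * b * t\<^sup>2 + 3 * b\<^sup>2 * t * x\<^sup>2 + b ^ 3 * x ^ 4))
      + (z + a * x\<^sup>2)\<^sup>2 + x + (t + b * x\<^sup>2) ^ 3 = 0"
    if "x\<^sup>2 * y + z\<^sup>2 + x + t ^ 3 = 0" for x y z t
    using that by algebra
  then show ?thesis
    using assms by (simp add: russell_cylinder_iff shift_def)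
qed

lemma affine_morphism_shift: "affine_morphism russell_cylinder russell_cylinder (shift a b c)"
  using shift_mem[of _ a b c] unfolding shift_def
  by (intro affine_morphism_pointI complex_polynomial_function_intros) simp

lemma shift_shift_minus: "shift (- a) (- b) (- c) (shift a b c p) = p"
  by (simp add: shift_def vec_eq_iff forall_coords algebra_simps power2_eq_square power3_eq_cube
      power4_eq_xxxx)

lemma aut_related_shift:
  assumes "p \<in> russell_cylinder"
  shows "aut_related russell_cylinder p (shift a b c p)"
  using shift_shift_minus[of a b c] shift_shift_minus[of "- a" "- b" "- c"] assms
  by (intro aut_relatedI[where g = "shift (- a) (- b) (- c)"]) (auto intro: affine_morphism_shift)

text \<open>
  The torus normalises \<open>x\<close>, since every complex number has a sixth root; translations then kill
  \<open>z\<close>, \<open>t\<close> and \<open>w\<close>, and the equation determines \<open>y\<close>.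
\<close>

lemma aut_related_base_point:
  assumes p: "p \<in> russell_cylinder" and "coord_x p \<noteq> 0"
  shows "aut_related russell_cylinder p (point 1 (- 1) 0 0 0)"
proof -
  define c where "c = exp (- Ln (coord_x p) / 6)"
  have "c \<noteq> 0"
    by (simp add: c_def)
  have "c ^ 6 * coord_x p = 1"
  proof -
    have "c ^ 6 = exp (- Ln (coord_x p))"
      unfolding c_def by (simp flip: exp_of_nat_mult)
    then show ?thesis
      using assms(2) by (simp add: exp_minus)
  qed
  define q where "q = torus c p"
  have pq: "aut_related russell_cylinder p q"
    unfolding q_def by (rule aut_related_torus) fact+
  have q: "q \<in> russell_cylinder" "coord_x q = 1"
    using pq \<open>c ^ 6 * coord_x p = 1\<close> by (simp_all add: aut_related_def q_def torus_def)
  define r where "r = shift (- coord_z q) (- coord_t q) (- coord_w q) q"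
  have qr: "aut_related russell_cylinder q r"
    unfolding r_def by (rule aut_related_shift) fact
  have r: "coord_x r = 1" "coord_z r = 0" "coord_t r = 0" "coord_w r = 0"
    using q by (simp_all add: r_def shift_def)
  moreover have "coord_y r = - 1"
    using qr r by (simp add: aut_related_def russell_cylinder_iff eq_neg_iff_add_eq_0)
  ultimately have "r = point 1 (- 1) 0 0 0"
    using point_of_coords[of r] by simp
  then show ?thesis
    using aut_related_trans[OF pq qr] by simp
qed

section \<open>An action of the additive group that moves x\<close>

definition fun_Z :: "complex^(4 + 1) \<Rightarrow> complex" where
  "fun_Z p = coord_z p - coord_x p * coord_w p"

definition fun_Y :: "complex^(4 + 1) \<Rightarrow> complex" where
  "fun_Y p = coord_y p + coord_w p ^ 2"

definition fun_u :: "complex^(4 + 1) \<Rightarrow> complex" where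
  "fun_u p = 1 + 2 * coord_w p * fun_Z p + coord_x p * fun_Y p"

definition fun_theta :: "complex^(4 + 1) \<Rightarrow> complex" where
  "fun_theta p = fun_Z p * fun_Y p - 2 * fun_u p * coord_w p"

lemma russell_cylinder_iff_fun_u:
  "p \<in> russell_cylinder \<longleftrightarrow> coord_x p * fun_u p + fun_Z p ^ 2 + coord_t p ^ 3 = 0"
proof -
  have "x * (1 + 2 * w * (z - x * w) + x * (y + w\<^sup>2)) + (z - x * w)\<^sup>2 + t ^ 3
      = x\<^sup>2 * y + z\<^sup>2 + x + t ^ 3" for x y z t w :: complex
    by algebra
  then show ?thesis
    by (simp add: russell_cylinder_iff fun_u_def fun_Z_def fun_Y_def)
qed

definition flow_t :: "complex \<Rightarrow> complex^(4 + 1) \<Rightarrow> complex" where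
  "flow_t s p = coord_t p + 2 * s * fun_u p ^ 2 * fun_theta p ^ 2"

text \<open>
  The increment of \<open>t\<^sup>3\<close> along the flow is \<open>2u\<^sup>2\<theta>\<^sup>2\<close> times this function. The increments of \<open>Z\<close>, \<open>w\<close>
  and \<open>x\<close>, computed from their expressions in \<open>(t, u, \<theta>, Y)\<close>, are multiples of it.
\<close>

definition flow_factor :: "complex \<Rightarrow> complex^(4 + 1) \<Rightarrow> complex" where
  "flow_factor s p = s * (coord_t p ^ 2 + coord_t p * flow_t s p + flow_t s p ^ 2)"

definition flow_Z :: "complex \<Rightarrow> complex^(4 + 1) \<Rightarrow> complex" where
  "flow_Z s p = fun_Z p - 2 * fun_theta p * fun_u p ^ 2 * flow_factor s p * fun_Y p"

definition flow_w :: "complex \<Rightarrow> complex^(4 + 1) \<Rightarrow> complex" where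
  "flow_w s p = coord_w p - fun_theta p * fun_u p * flow_factor s p * fun_Y p ^ 2"

definition flow_x :: "complex \<Rightarrow> complex^(4 + 1) \<Rightarrow> complex" where
  "flow_x s p = coord_x p - 2 * fun_u p ^ 2 * (fun_u p - 1) * flow_factor s p * fun_Y p
     - 2 * fun_u p * flow_factor s p * fun_Y p ^ 2 * flow_t s p ^ 3
     + 4 * fun_theta p * fun_u p ^ 2 * flow_factor s p * coord_w p"

definition cylinder_flow :: "complex \<Rightarrow> complex^(4 + 1) \<Rightarrow> complex^(4 + 1)" where
  "cylinder_flow s p = point (flow_x s p) (fun_Y p - flow_w s p ^ 2)
     (flow_Z s p + flow_x s p * flow_w s p) (flow_t s p) (flow_w s p)"

lemma cylinder_flow_coords:
  "coord_x (cylinder_flow s p) = flow_x s p" "fun_Y (cylinder_flow s p) = fun_Y p"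
  "fun_Z (cylinder_flow s p) = flow_Z s p" "coord_t (cylinder_flow s p) = flow_t s p"
  "coord_w (cylinder_flow s p) = flow_w s p"
  by (simp_all add: cylinder_flow_def fun_Y_def fun_Z_def)

lemma flow_t_cubed:
  "flow_t s p ^ 3 = coord_t p ^ 3 + 2 * fun_theta p ^ 2 * fun_u p ^ 2 * flow_factor s p"
  unfolding flow_factor_def flow_t_def by algebra

text \<open>
  This relation, which gives \<open>Z\<close> in the chart, is why the flow preserves \<open>u\<close> and the equation of
  the cylinder.
\<close>

lemma fun_theta_times_fun_Z:
  assumes "p \<in> russell_cylinder"
  shows "fun_theta p * fun_Z p + coord_t p ^ 3 * fun_Y p + fun_u p * (fun_u p - 1) = 0"
proof -
  have "(Z * Y - 2 * u * w) * Z + t ^ 3 * Y + u * (u - 1) = 0"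
    if "x * u + Z\<^sup>2 + t ^ 3 = 0" "u = 1 + 2 * w * Z + x * Y" for x Y Z t w u :: complex
    using that by algebra
  then show ?thesis
    using assms fun_u_def by (simp add: russell_cylinder_iff_fun_u fun_theta_def)
qed

lemma fun_u_cylinder_flow:
  assumes "p \<in> russell_cylinder"
  shows "fun_u (cylinder_flow s p) = fun_u p"
proof -
  have "1 + 2 * (w - \<theta> * u * k * Y\<^sup>2) * (Z - 2 * \<theta> * u\<^sup>2 * k * Y)
      + (x - 2 * u\<^sup>2 * (u - 1) * k * Y - 2 * u * k * Y\<^sup>2 * T + 4 * \<theta> * u\<^sup>2 * k * w) * Y = u"
    if "\<theta> * Z + t * Y + u * (u - 1) = 0" "T = t + 2 * \<theta>\<^sup>2 * u\<^sup>2 * k" "u = 1 + 2 * w * Z + x * Y"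
    for x Y Z t T w u \<theta> k :: complex
    using that by algebra
  from this[OF fun_theta_times_fun_Z[OF assms] flow_t_cubed[of s p] fun_u_def[of p]]
  show ?thesis
    by (simp add: fun_u_def[of "cylinder_flow s p"] cylinder_flow_coords flow_x_def flow_w_def
        flow_Z_def)
qed

lemma fun_theta_cylinder_flow:
  assumes "p \<in> russell_cylinder"
  shows "fun_theta (cylinder_flow s p) = fun_theta p"
proof -
  have "(Z - 2 * \<theta> * u\<^sup>2 * k * Y) * Y - 2 * u * (w - \<theta> * u * k * Y\<^sup>2) = \<theta>"
    if "\<theta> = Z * Y - 2 * u * w" for Y Z w u \<theta> k :: complex
    using that by algebra
  from this[OF fun_theta_def[of p]] show ?thesis
    by (simp add: fun_theta_def[of "cylinder_flow s p"] cylinder_flow_coords flow_w_def flow_Z_def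
        fun_u_cylinder_flow[OF assms])
qed

lemma cylinder_flow_mem:
  assumes "p \<in> russell_cylinder"
  shows "cylinder_flow s p \<in> russell_cylinder"
proof -
  have "(x - 2 * u\<^sup>2 * (u - 1) * k * Y - 2 * u * k * Y\<^sup>2 * T + 4 * \<theta> * u\<^sup>2 * k * w) * u
      + (Z - 2 * \<theta> * u\<^sup>2 * k * Y)\<^sup>2 + T = 0"
    if "\<theta> * Z + t * Y + u * (u - 1) = 0" "T = t + 2 * \<theta>\<^sup>2 * u\<^sup>2 * k" "\<theta> = Z * Y - 2 * u * w"
      "x * u + Z\<^sup>2 + t = 0"
    for x Y Z t T w u \<theta> k :: complex
  proof -
    have "(x - 2 * u\<^sup>2 * (u - 1) * k * Y - 2 * u * k * Y\<^sup>2 * T + 4 * \<theta> * u\<^sup>2 * k * w) * u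
        + (Z - 2 * \<theta> * u\<^sup>2 * k * Y)\<^sup>2 + T
      = (x * u + Z\<^sup>2 + t) - 2 * u\<^sup>2 * k * Y * (\<theta> * Z + t * Y + u * (u - 1))
        + 2 * u\<^sup>2 * k * \<theta> * (\<theta> - (Z * Y - 2 * u * w))"
      unfolding that(2) by algebra
    then show ?thesis
      using that by simp
  qed
  from this[OF fun_theta_times_fun_Z[OF assms] flow_t_cubed[of s p] fun_theta_def[of p]] assms
  show ?thesis
    unfolding russell_cylinder_iff_fun_u cylinder_flow_coords fun_u_cylinder_flow[OF assms]
    by (simp add: flow_x_def flow_Z_def)
qed

lemma cylinder_flow_minus:
  assumes "p \<in> russell_cylinder"
  shows "cylinder_flow (- s) (cylinder_flow s p) = p"
proof -
  let ?q = "cylinder_flow s p"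
  note inv = cylinder_flow_coords fun_u_cylinder_flow[OF assms] fun_theta_cylinder_flow[OF assms]
  have t: "flow_t (- s) ?q = coord_t p"
    by (simp add: flow_t_def[of "- s"] inv) (simp add: flow_t_def)
  have k: "flow_factor (- s) ?q = - flow_factor s p"
    by (simp add: flow_factor_def t inv algebra_simps)
  have Z: "flow_Z (- s) ?q = fun_Z p"
    by (simp add: flow_Z_def[of "- s"] k inv) (simp add: flow_Z_def)
  have w: "flow_w (- s) ?q = coord_w p"
    by (simp add: flow_w_def[of "- s"] k inv) (simp add: flow_w_def)
  have x: "flow_x (- s) ?q = coord_x p"
  proof -
    have "(x - 2 * u\<^sup>2 * (u - 1) * k * Y - 2 * u * k * Y\<^sup>2 * (t + 2 * \<theta>\<^sup>2 * u\<^sup>2 * k)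
          + 4 * \<theta> * u\<^sup>2 * k * w)
        - 2 * u\<^sup>2 * (u - 1) * (- k) * Y - 2 * u * (- k) * Y\<^sup>2 * t
        + 4 * \<theta> * u\<^sup>2 * (- k) * (w - \<theta> * u * k * Y\<^sup>2) = x"
      for x Y t w u \<theta> k :: complex
      by (simp add: algebra_simps power2_eq_square)
    then show ?thesis
      unfolding flow_x_def[of "- s"] k t inv unfolding flow_x_def flow_w_def flow_t_cubed by simp
  qed
  have "cylinder_flow (- s) ?q = point (coord_x p) (fun_Y p - coord_w p ^ 2)
      (fun_Z p + coord_x p * coord_w p) (coord_t p) (coord_w p)"
    by (simp add: cylinder_flow_def[of "- s"] x Z t w inv)
  also have "\<dots> = p"
    using point_of_coords[of p] by (simp add: fun_Y_def fun_Z_def)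
  finally show ?thesis .
qed

lemma affine_morphism_cylinder_flow:
  "affine_morphism russell_cylinder russell_cylinder (cylinder_flow s)"
proof -
  note intros = complex_polynomial_function_intros
  have Z: "complex_polynomial_function fun_Z" and Y: "complex_polynomial_function fun_Y"
    unfolding fun_Z_def fun_Y_def by (intro intros)+
  have u: "complex_polynomial_function fun_u"
    unfolding fun_u_def by (intro intros Z Y)
  have theta: "complex_polynomial_function fun_theta"
    unfolding fun_theta_def by (intro intros Z Y u)
  have t: "complex_polynomial_function (flow_t s)"
    unfolding flow_t_def by (intro intros u theta)
  have k: "complex_polynomial_function (flow_factor s)"
    unfolding flow_factor_def by (intro intros t)
  have "complex_polynomial_function (flow_Z s)" "complex_polynomial_function (flow_w s)"
    "complex_polynomial_function (flow_x s)"
    unfolding flow_Z_def flow_w_def flow_x_def by (intro intros Z Y u theta t k)+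
  then show ?thesis
    using cylinder_flow_mem[of _ s] t Y unfolding cylinder_flow_def
    by (intro affine_morphism_pointI intros) simp
qed

lemma aut_related_cylinder_flow:
  assumes "p \<in> russell_cylinder"
  shows "aut_related russell_cylinder p (cylinder_flow s p)"
  using cylinder_flow_minus[of _ s] cylinder_flow_minus[of _ "- s"] assms
  by (intro aut_relatedI[where g = "cylinder_flow (- s)"])
    (auto intro: affine_morphism_cylinder_flow)

section \<open>Leaving the section x = 0\<close>

lemma exists_poly_nonzero:
  fixes p :: "complex poly"
  assumes "p \<noteq> 0"
  shows "\<exists>a. poly p a \<noteq> 0"
  using assms poly_all_0_iff_0 by blast

lemma flow_x_on_zero_section:
  assumes "p \<in> russell_cylinder" "coord_x p = 0"
  shows "flow_x s p = - 2 * flow_factor s p * fun_u p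
    * (fun_Y p ^ 2 * flow_t s p ^ 3 + 4 * fun_u p ^ 2 * coord_w p ^ 2)"
proof -
  have "- 2 * u\<^sup>2 * (u - 1) * k * Y - 2 * u * k * Y\<^sup>2 * T + 4 * (Z * Y - 2 * u * w) * u\<^sup>2 * k * w
      = - 2 * k * u * (Y\<^sup>2 * T + 4 * u\<^sup>2 * w\<^sup>2)"
    if "u = 1 + 2 * w * Z" for u k Y Z w T :: complex
    using that by algebra
  from this[of "fun_u p" "coord_w p" "fun_Z p"] assms(2) show ?thesis
    by (simp add: flow_x_def fun_theta_def fun_u_def[of p])
qed

text \<open>
  A translation of \<open>w\<close> leads into the chart: for \<open>x = 0\<close>, none of \<open>w\<close>, \<open>u\<close> and \<open>\<theta>\<close> vanishes
  identically as a polynomial in \<open>w\<close>. In the chart the flow gives \<open>t\<close> any prescribed value, and for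
  a general one the new value of \<open>x\<close> is not zero.
\<close>

lemma cylinder_flow_leaves_zero_section:
  assumes p: "p \<in> russell_cylinder" and x0: "coord_x p = 0"
  shows "\<exists>q. aut_related russell_cylinder p q \<and> coord_x q \<noteq> 0"
proof -
  define y z where "y = coord_y p" and "z = coord_z p"
  have "[:0, 1:] * [:1, 2 * z:] * [:z * y, - 2, - 3 * z:] \<noteq> 0"
    unfolding mult_eq_0_iff by simp
  then obtain w where "poly ([:0, 1:] * [:1, 2 * z:] * [:z * y, - 2, - 3 * z:]) w \<noteq> 0"
    using exists_poly_nonzero by blast
  then have w: "w \<noteq> 0" "1 + 2 * w * z \<noteq> 0" "z * y - 2 * w - 3 * z * w\<^sup>2 \<noteq> 0"
    unfolding poly_mult mult_eq_0_iff by (auto simp: algebra_simps power2_eq_square)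
  define q where "q = shift 0 0 (w - coord_w p) p"
  have pq: "aut_related russell_cylinder p q"
    unfolding q_def by (rule aut_related_shift) fact
  then have q: "q \<in> russell_cylinder"
    by (simp add: aut_related_def)
  have q_coords: "coord_x q = 0" "coord_y q = y" "coord_z q = z" "coord_w q = w"
    by (simp_all add: q_def shift_def x0 y_def z_def)
  have u: "fun_u q \<noteq> 0"
    using w(2) by (simp add: fun_u_def fun_Z_def q_coords)
  have theta: "fun_theta q \<noteq> 0"
    using w(3)
    by (simp add: fun_theta_def fun_u_def fun_Z_def fun_Y_def q_coords algebra_simps
        power2_eq_square)
  define Y t e where "Y = fun_Y q" and "t = coord_t q" and "e = 4 * fun_u q ^ 2 * w\<^sup>2"
  have "e \<noteq> 0"
    using u w(1) by (simp add: e_def)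
  then have "[:- t, 1:] * [:t\<^sup>2, t, 1:] * [:e, 0, 0, Y\<^sup>2:] \<noteq> 0"
    unfolding mult_eq_0_iff by simp
  then obtain T where "poly ([:- t, 1:] * [:t\<^sup>2, t, 1:] * [:e, 0, 0, Y\<^sup>2:]) T \<noteq> 0"
    using exists_poly_nonzero by blast
  then have T: "T \<noteq> t" "t\<^sup>2 + t * T + T\<^sup>2 \<noteq> 0" "Y\<^sup>2 * T ^ 3 + e \<noteq> 0"
    unfolding poly_mult mult_eq_0_iff
    by (auto simp: algebra_simps power2_eq_square power3_eq_cube)
  define s where "s = (T - t) / (2 * fun_u q ^ 2 * fun_theta q ^ 2)"
  have "2 * s * fun_u q ^ 2 * fun_theta q ^ 2 = T - t"
    using u theta by (simp add: s_def)
  then have flow: "flow_t s q = T"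
    by (simp add: flow_t_def t_def)
  have "s \<noteq> 0"
    using T(1) u theta by (simp add: s_def)
  then have "flow_factor s q \<noteq> 0"
    using T(2) by (simp add: flow_factor_def flow t_def)
  then have "flow_x s q \<noteq> 0"
    using T(3) u by (simp add: flow_x_on_zero_section[OF q q_coords(1)] flow Y_def e_def q_coords)
  then have "coord_x (cylinder_flow s q) \<noteq> 0"
    by (simp add: cylinder_flow_coords)
  then show ?thesis
    using aut_related_trans[OF pq aut_related_cylinder_flow[OF q]] by blast
qed

theorem corollary1p3:
  shows "transitive_action
    (variety_Aut (variety_prod russell_cubic affine_line))
    (variety_prod russell_cubic affine_line)
    (\<lambda>g. g)"
proof (rule transitive_action_variety_AutI)
  fix p
  assume p: "p \<in> russell_cylinder"
  show "aut_related russell_cylinder p (point 1 (- 1) 0 0 0)"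
  proof (cases "coord_x p = 0")
    case True
    then obtain q where q: "aut_related russell_cylinder p q" "coord_x q \<noteq> 0"
      using cylinder_flow_leaves_zero_section p by blast
    then have "aut_related russell_cylinder q (point 1 (- 1) 0 0 0)"
      by (intro aut_related_base_point) (simp_all add: aut_related_def)
    with q(1) show ?thesis
      by (rule aut_related_trans)
  next
    case False
    with p show ?thesis
      by (rule aut_related_base_point)
  qed
qed

end
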